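(* Let $\lambda$ be a nonzero real number and $n$ a positive integer. Define $T_{m,\lambda}^{(1)}(n)$, $m\ge0$, by \[ {}_1F_{0}\big(-n;\,;e_{\lambda}(t)\big)=\sum_{m=0}^{\infty}T_{m,\lambda}^{(1)}(n)\frac{t^{m}}{m!}, \] where ${}_1F_0(-n;\,;z)=\sum_{k\ge0}\langle -n\rangle_k\frac{z^k}{k!}$. Then for every integer $m\ge n$, \[ T_{m,\lambda}^{(1)}(n)=\sum_{j=0}^{n}\binom{n}{j}(-1)^{j}(j)_{m,\lambda}=(-1)^{n}n!\,S_{2,\lambda}(m,n), \] and if $0\le m<n$, then $T_{m,\lambda}^{(1)}(n)=0$.
   Context: $\langle a\rangle_0=1$, $\langle a\rangle_k=a(a+1)\cdots(a+k-1)$ (ordinary rising factorial). $e_{\lambda}(t)=(1+\lambda t)^{1/\lambda}$; $(x)_{0,\lambda}=1$, $(x)_{m,\lambda}=x(x-\lambda)\cdots(x-(m-1)\lambda)$. The degenerate Stirling numbers of the second kind are defined by $\frac{1}{k!}(e_{\lambda}(t)-1)^{k}=\sum_{n\ge k}S_{2,\lambda}(n,k)\frac{t^{n}}{n!}$. *)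

theory Defs
  imports "HOL-Analysis.Analysis"
begin

text \<open>
  Generating functions are formal power series in \<open>t = fps_X\<close> over the reals.
  The series of \<open>(1 + \<lambda>t)\<^bsup>1/\<lambda>\<^esup>\<close> is the binomial series with exponent \<open>1/\<lambda>\<close>
  taken at \<open>\<lambda>t\<close>; \<open>deg_exp_sums\<close> below confirms that it represents the analytic function.
\<close>

definition deg_exp :: "real \<Rightarrow> real fps" where
  "deg_exp l = fps_compose (fps_binomial (1 / l)) (fps_const l * fps_X)"

definition deg_ffact :: "real \<Rightarrow> real \<Rightarrow> nat \<Rightarrow> real" where
  "deg_ffact l x m = (\<Prod>i<m. x - real i * l)"

definition deg_Stirling2 :: "real \<Rightarrow> nat \<Rightarrow> nat \<Rightarrow> real" where
  "deg_Stirling2 l n k = fact n * fps_nth (fps_const (1 / fact k) * (deg_exp l - 1) ^ k) n"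

text \<open>
  The infinite sum is taken in the \<open>t\<close>-adic topology. As \<open>z\<close> may have a nonzero
  constant term, it need not converge in general, but it terminates when \<open>a\<close> is a
  nonpositive integer (\<open>hypergeom_1F0_summable\<close>).
\<close>

definition hypergeom_1F0 :: "real \<Rightarrow> real fps \<Rightarrow> real fps" where
  "hypergeom_1F0 a z = (\<Sum>k. fps_const (pochhammer a k / fact k) * z ^ k)"

definition T1 :: "real \<Rightarrow> nat \<Rightarrow> nat \<Rightarrow> real" where
  "T1 l m n = fact m * fps_nth (hypergeom_1F0 (- real n) (deg_exp l)) m"

lemma deg_exp_sums:
  assumes "\<bar>l * t\<bar> < 1"
  shows "(\<lambda>k. fps_nth (deg_exp l) k * t ^ k) sums ((1 + l * t) powr (1 / l))"
  using gen_binomial_real[OF assms, of "1 / l"]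
  unfolding deg_exp_def fps_compose_linear
  by (simp add: power_mult_distrib mult_ac)

lemma hypergeom_1F0_summable:
  "summable (\<lambda>k. fps_const (pochhammer (- real n) k / fact k) * z ^ k)"
proof (rule summable_finite[of "{..n}"])
  fix k assume "k \<notin> {..n}"
  then show "fps_const (pochhammer (- real n) k / fact k) * z ^ k = 0"
    by (simp add: pochhammer_of_nat_eq_0_lemma)
qed simp

end

theory Submission
  imports Defs
begin

text \<open>By the binomial theorem the terminating series at -n is (1 - z)^n; the result follows
  from reading m! [t^m] of it at z = \<open>deg_exp l\<close> in two ways. Expanded, it is a signed
  sum of the powers \<open>deg_exp l ^ j\<close>, that is (1 + lt)^(j/l), whose coefficients are the
  degenerate falling factorials (\<open>deg_exp_power_nth\<close>). Unexpanded, it is (-1)^n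
  (\<open>deg_exp l\<close> - 1)^n, which is n! times the generating function of the Stirling
  numbers up to sign. Since \<open>deg_exp l\<close> has constant term 1, t^n divides it, whence the
  vanishing below n.\<close>

lemma hypergeom_1F0_neg_of_nat_sum:
  "hypergeom_1F0 (- real n) z = (\<Sum>k=0..n. fps_const (real (n choose k) * (-1) ^ k) * z ^ k)"
proof -
  \<comment> \<open>\<open>gbinomial_pochhammer\<close> has the sign next to the Pochhammer symbol;
    it changes sides because (-1)^k squares to 1.\<close>
  have coeff: "pochhammer (- real n) k / fact k = real (n choose k) * (-1) ^ k" for k
    using gbinomial_pochhammer[of "real n" k]
    by (simp add: binomial_gbinomial flip: mult.assoc power_mult_distrib)
  show ?thesis
    unfolding hypergeom_1F0_def coeff
    by (rule suminf_finite) (auto simp: not_le binomial_eq_0)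
qed

lemma hypergeom_1F0_neg_of_nat: "hypergeom_1F0 (- real n) z = (1 - z) ^ n"
proof -
  have "(1 - z) ^ n = (- z + 1) ^ n"
    by simp
  also have "\<dots> = (\<Sum>k\<le>n. of_nat (n choose k) * (- z) ^ k * 1 ^ (n - k))"
    by (rule binomial_ring)
  also have "\<dots> = (\<Sum>k=0..n. fps_const (real (n choose k) * (-1) ^ k) * z ^ k)"
  proof (rule sum.cong)
    fix k
    have "(- z) ^ k = fps_const ((-1) ^ k) * z ^ k"
      by (cases "even k") (simp_all flip: fps_const_neg)
    then show "of_nat (n choose k) * (- z) ^ k * 1 ^ (n - k)
        = fps_const (real (n choose k) * (-1) ^ k) * z ^ k"
      by (simp add: fps_of_nat mult.assoc flip: fps_const_mult)
  qed auto
  finally show ?thesis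
    by (simp add: hypergeom_1F0_neg_of_nat_sum)
qed

lemma deg_exp_nth_0: "fps_nth (deg_exp l) 0 = 1"
  by (simp add: deg_exp_def)

text \<open>Exponents of binomial series add under multiplication, and substituting lt, which has no
  constant term, commutes with powers.\<close>

lemma deg_exp_power:
  "deg_exp l ^ j = fps_compose (fps_binomial (real j / l)) (fps_const l * fps_X)"
proof -
  have "fps_binomial (1 / l) ^ j = fps_binomial (real j / l)"
    by (simp add: fps_binomial_power)
  then show ?thesis
    by (simp add: deg_exp_def fps_compose_power)
qed

text \<open>Taking l out of each of the m factors leaves the ordinary falling factorial of x/l. This
  matches the binomial series, where substituting lt scales the m-th coefficient by l^m.\<close>

lemma deg_ffact_eq_gbinomial:
  assumes "l \<noteq> 0"
  shows "deg_ffact l x m = fact m * (l ^ m * ((x / l) gchoose m))"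
proof -
  have "deg_ffact l x m = (\<Prod>i<m. l * (x / l - real i))"
    unfolding deg_ffact_def using assms by (simp add: right_diff_distrib mult.commute)
  also have "\<dots> = l ^ m * (\<Prod>i<m. x / l - real i)"
    by (simp add: prod.distrib)
  also have "\<dots> = fact m * (l ^ m * ((x / l) gchoose m))"
    by (simp add: gbinomial_prod_rev atLeast0LessThan)
  finally show ?thesis .
qed

lemma deg_exp_power_nth:
  assumes "l \<noteq> 0"
  shows "fact m * fps_nth (deg_exp l ^ j) m = deg_ffact l (real j) m"
  by (simp add: deg_exp_power fps_compose_linear deg_ffact_eq_gbinomial[OF assms])

theorem theorem3p1:
  fixes l :: real and n :: nat
  assumes "l \<noteq> 0" and "n \<ge> 1"
  shows "(\<forall>m\<ge>n.
            T1 l m n = (\<Sum>j=0..n. real (n choose j) * (-1) ^ j * deg_ffact l (real j) m) \<and>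
            (\<Sum>j=0..n. real (n choose j) * (-1) ^ j * deg_ffact l (real j) m)
              = (-1) ^ n * fact n * deg_Stirling2 l m n) \<and>
         (\<forall>m<n. T1 l m n = 0)"
proof -
  have sum_eq: "T1 l m n = (\<Sum>j=0..n. real (n choose j) * (-1) ^ j * deg_ffact l (real j) m)" for m
    by (simp add: T1_def hypergeom_1F0_neg_of_nat_sum fps_sum_nth sum_distrib_left
        mult.left_commute flip: deg_exp_power_nth[OF assms(1)])
  have stirling_eq: "T1 l m n = (-1) ^ n * fact n * deg_Stirling2 l m n" for m
  proof -
    have "(1 - deg_exp l) ^ n = (fps_const (-1) * (deg_exp l - 1)) ^ n"
      by (simp flip: fps_const_neg)
    also have "\<dots> = fps_const ((-1) ^ n) * (deg_exp l - 1) ^ n"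
      by (simp only: power_mult_distrib fps_const_power)
    finally show ?thesis
      by (simp add: T1_def deg_Stirling2_def hypergeom_1F0_neg_of_nat)
  qed
  \<comment> \<open>The n-th power of a series without constant term has no coefficient below degree
    n.\<close>
  have "T1 l m n = 0" if "m < n" for m
    using that startsby_zero_power_prefix[of "1 - deg_exp l" n]
    by (simp add: T1_def hypergeom_1F0_neg_of_nat deg_exp_nth_0)
  with sum_eq stirling_eq show ?thesis
    by metis
qed

end
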